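(* Let $K,t,s$ be positive integers with $t\ge 2$, $t\mid K$, $t<K$ and $s\le K$, put $r=K-t$, and let $T$ be a positive integer divisible by $r-1$. Then there exists a CDC scheme with IVA length $T$, $K$ nodes, $N=\left(\frac{K}{t}-1\right)\left(\frac{K}{t}\right)^{t-1}$ files and $Q=\frac{K}{\gcd(K,s)}$ output functions, in which each output function is computed by exactly $s$ nodes, with computation load $r=K-t$ and communication load $\frac{s}{r-1}\left(1-\frac{r}{K}\right)$.
   Context: **CDC scheme.** There are $K$ nodes $0,\dots,K-1$, $N$ files $w_0,\dots,w_{N-1}$, and $Q$ output functions $\phi_0,\dots,\phi_{Q-1}$, where $\phi_q(w_0,\dots,w_{N-1})=h_q(v_{q,0},\dots,v_{q,N-1})$ and $v_{q,n}=g_{q,n}(w_n)\in\{0,1\}^T$ is called an intermediate value (IVA) of length $T$ bits; the map functions $g_{q,n}$ and reduce functions $h_q$ are arbitrary, so the IVAs $v_{q,n}$ are to be regarded as arbitrary elements of $\{0,1\}^T$. A CDC scheme consists of: - for each node $k$, a set $\mathcal W_k$ of stored files and a set $\mathcal Q_k$ of output functions it must compute (with node $k$ knowing locally exactly the IVAs $\mathcal C_k=\{v_{q,n}: 0\le q\le Q-1,\ w_n\in\mathcal W_k\}$); - for each node $k$, an encoding function producing a message $X_k$ of $l_k$ bits from $\mathcal C_k$, which is received error-free by all other nodes; - decoding functions such that each node $k$, from $X_0,\dots,X_{K-1}$ and $\mathcal C_k$, recovers all $v_{q,n}$ with $\phi_q\in\mathcal Q_k$ and $0\le n\le N-1$,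 for every possible value of the IVAs. The computation load is $\frac{1}{N}\sum_{k=0}^{K-1}|\mathcal W_k|$ and the communication load is $\frac{1}{QNT}\sum_{k=0}^{K-1} l_k$. An output function is computed by exactly $s$ nodes if it belongs to exactly $s$ of the sets $\mathcal Q_k$. *)

theory Defs
  imports Complex_Main
begin

text \<open>
  Nodes, files and output functions are the numbers below \<open>K\<close>, \<open>N\<close> and \<open>Q\<close>; the components of a
  scheme carry no meaning outside these ranges. Since the map and reduce functions are arbitrary,
  a scheme only sees the intermediate values \<open>v q n\<close>, arbitrary bit strings of length \<open>T\<close>.
\<close>

type_synonym bits = "bool list"

text \<open>The IVAs available locally at a node, keyed by pairs (output function, file).\<close>
type_synonym local_ivas = "nat \<times> nat \<Rightarrow> bits option"

record cdc =
  stored :: "nat \<Rightarrow> nat set"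
  assigned :: "nat \<Rightarrow> nat set"
  msg_len :: "nat \<Rightarrow> nat"
  encode :: "nat \<Rightarrow> local_ivas \<Rightarrow> bits"
  decode :: "nat \<Rightarrow> bits list \<Rightarrow> local_ivas \<Rightarrow> nat \<Rightarrow> nat \<Rightarrow> bits"

definition iva_family :: "nat \<Rightarrow> nat \<Rightarrow> nat \<Rightarrow> (nat \<Rightarrow> nat \<Rightarrow> bits) \<Rightarrow> bool" where
  "iva_family N Q T v \<longleftrightarrow> (\<forall>q<Q. \<forall>n<N. length (v q n) = T)"

definition known_ivas :: "nat \<Rightarrow> cdc \<Rightarrow> (nat \<Rightarrow> nat \<Rightarrow> bits) \<Rightarrow> nat \<Rightarrow> local_ivas" where
  "known_ivas Q S v k = (\<lambda>(q, n). Some (v q n)) |` ({..<Q} \<times> stored S k)"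

definition message :: "nat \<Rightarrow> cdc \<Rightarrow> (nat \<Rightarrow> nat \<Rightarrow> bits) \<Rightarrow> nat \<Rightarrow> bits" where
  "message Q S v k = encode S k (known_ivas Q S v k)"

definition messages :: "nat \<Rightarrow> nat \<Rightarrow> cdc \<Rightarrow> (nat \<Rightarrow> nat \<Rightarrow> bits) \<Rightarrow> bits list" where
  "messages K Q S v = map (message Q S v) [0..<K]"

definition cdc_scheme :: "nat \<Rightarrow> nat \<Rightarrow> nat \<Rightarrow> nat \<Rightarrow> cdc \<Rightarrow> bool" where
  "cdc_scheme K N Q T S \<longleftrightarrow>
     (\<forall>k<K. stored S k \<subseteq> {..<N} \<and> assigned S k \<subseteq> {..<Q}) \<and>
     (\<forall>v. iva_family N Q T v \<longrightarrow>
        (\<forall>k<K. length (message Q S v k) = msg_len S k \<and>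
           (\<forall>q\<in>assigned S k. \<forall>n<N.
              decode S k (messages K Q S v) (known_ivas Q S v k) q n = v q n)))"

definition computation_load :: "nat \<Rightarrow> nat \<Rightarrow> cdc \<Rightarrow> real" where
  "computation_load K N S = 1 / real N * (\<Sum>k<K. real (card (stored S k)))"

definition communication_load :: "nat \<Rightarrow> nat \<Rightarrow> nat \<Rightarrow> nat \<Rightarrow> cdc \<Rightarrow> real" where
  "communication_load K N Q T S =
     1 / (real Q * real N * real T) * (\<Sum>k<K. real (msg_len S k))"

definition computed_by_exactly :: "nat \<Rightarrow> nat \<Rightarrow> cdc \<Rightarrow> nat \<Rightarrow> bool" where
  "computed_by_exactly K s S q \<longleftrightarrow> card {k. k < K \<and> q \<in> assigned S k} = s"

end

theory Submission
  imports Defs "HOL-Library.FuncSet" "HOL-Number_Theory.Cong"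
begin

text \<open>
  Write \<open>m = K div t\<close> and identify node \<open>k\<close> with the pair \<open>(k div m, k mod m)\<close>. Files are the
  vectors \<open>c \<in> {0..<m}\<^sup>t\<close> whose coordinate sum is nonzero modulo \<open>m\<close>, and node \<open>(i, x)\<close> stores \<open>c\<close>
  iff \<open>c i \<noteq> x\<close>. Every vector \<open>b\<close> with coordinate sum zero defines a multicast group consisting of
  the \<open>K - t\<close> nodes \<open>(i, x)\<close> with \<open>b i \<noteq> x\<close>. In it, node \<open>(i, x)\<close> lacks the file \<open>b(i := x)\<close>, which
  all the other members store; and every file missing at a node arises so from exactly one group,
  since one coordinate can be changed in exactly one way to make the sum zero. The bits of the
  intermediate value wanted by a member are spread evenly over the other \<open>r - 1\<close> members, and each
  member broadcasts the exclusive or of the parts entrusted to it.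
\<close>

section \<open>Exclusive-or multicasting within overlapping groups\<close>

text \<open>The parity of a count is the exclusive or of the truth values, so this is cancellation
  modulo 2. It lets a receiver strip the bits it knows off a broadcast bit.\<close>

lemma odd_card_eq_imp:
  assumes "finite A" "a \<in> A"
    and "\<And>x. x \<in> A - {a} \<Longrightarrow> P x \<longleftrightarrow> P' x"
    and "odd (card {x \<in> A. P x}) = odd (card {x \<in> A. P' x})"
  shows "P a \<longleftrightarrow> P' a"
proof -
  define C where "C = {x \<in> A - {a}. P x}"
  have "finite C" "a \<notin> C"
    using assms(1) by (auto simp: C_def)
  moreover have "{x \<in> A. P x} = (if P a then insert a C else C)"
    "{x \<in> A. P' x} = (if P' a then insert a C else C)"
    using assms(2,3) by (auto simp: C_def)
  ultimately show ?thesis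
    using assms(4) by (auto split: if_splits)
qed

text \<open>Avoids explicit decoders: a node may pick any family consistent with the messages and
  its local values. The true family is one, and by \<open>determined\<close> all of them agree on
  the wanted values.\<close>

lemma cdc_scheme_of_determined:
  assumes range: "\<And>k. k < K \<Longrightarrow> stored S k \<subseteq> {..<N} \<and> assigned S k \<subseteq> {..<Q}"
    and len: "\<And>v k. k < K \<Longrightarrow> length (message Q S v k) = msg_len S k"
    and determined: "\<And>v v' k q n. iva_family N Q T v \<Longrightarrow> iva_family N Q T v' \<Longrightarrow>
      messages K Q S v = messages K Q S v' \<Longrightarrow> known_ivas Q S v k = known_ivas Q S v' k \<Longrightarrow>
      k < K \<Longrightarrow> q \<in> assigned S k \<Longrightarrow> n < N \<Longrightarrow> v q n = v' q n"
  obtains D where "cdc_scheme K N Q T (S\<lparr>decode := D\<rparr>)"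
proof
  define D where "D k ms iv = (SOME v. iva_family N Q T v \<and> messages K Q S v = ms \<and>
    known_ivas Q S v k = iv)" for k ms iv
  have same: "known_ivas Q (S\<lparr>decode := D\<rparr>) = known_ivas Q S"
    "message Q (S\<lparr>decode := D\<rparr>) = message Q S" "messages K Q (S\<lparr>decode := D\<rparr>) = messages K Q S"
    by (simp_all add: fun_eq_iff known_ivas_def message_def messages_def)
  have "D k (messages K Q S v) (known_ivas Q S v k) q n = v q n"
    if v: "iva_family N Q T v" and "k < K" "q \<in> assigned S k" "n < N" for v k q n
  proof -
    let ?v' = "D k (messages K Q S v) (known_ivas Q S v k)"
    have "iva_family N Q T ?v' \<and> messages K Q S ?v' = messages K Q S v \<and>
        known_ivas Q S ?v' k = known_ivas Q S v k"
      unfolding D_def using someI[where x = v] v by (metis (mono_tags, lifting))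
    then show ?thesis
      using determined that by metis
  qed
  then show "cdc_scheme K N Q T (S\<lparr>decode := D\<rparr>)"
    using range len by (simp add: cdc_scheme_def same)
qed

text \<open>Each group \<open>b\<close> serves its member \<open>k\<close> with the file
  \<open>f b k\<close>, which the other \<open>r'\<close> members store. A value of
  \<open>r' * L\<close> bits is cut into \<open>L\<close> bits per other member, so node
  \<open>k\<close> sends \<open>s' * L\<close> bits for each of its groups.\<close>

lemma coded_multicast_scheme:
  fixes G :: "'b \<Rightarrow> nat set" and f :: "'b \<Rightarrow> nat \<Rightarrow> nat"
  assumes B: "finite B"
    and G: "\<And>b. b \<in> B \<Longrightarrow> G b \<subseteq> {..<K} \<and> card (G b) = Suc r'"
    and st: "\<And>k. k < K \<Longrightarrow> st k \<subseteq> {..<N}"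
    and asg: "\<And>k. k < K \<Longrightarrow> as k \<subseteq> {..<Q} \<and> card (as k) = s'"
    and f: "\<And>b k. b \<in> B \<Longrightarrow> k \<in> G b \<Longrightarrow> f b k < N"
    and known: "\<And>b k k'. b \<in> B \<Longrightarrow> k \<in> G b \<Longrightarrow> k' \<in> G b \<Longrightarrow> k' \<noteq> k \<Longrightarrow> f b k \<in> st k'"
    and cover: "\<And>k n. k < K \<Longrightarrow> n < N \<Longrightarrow> n \<notin> st k \<Longrightarrow> \<exists>b\<in>B. k \<in> G b \<and> f b k = n"
  obtains S where "cdc_scheme K N Q (r' * L) S" "stored S = st" "assigned S = as"
    "\<And>k. msg_len S k = s' * L * card {b \<in> B. k \<in> G b}"
proof -
  have fin_G: "finite (G b)" if "b \<in> B" for b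
    using G[OF that] finite_subset by blast
  \<comment> \<open>Numbering the functions of each node lets one broadcast bit combine the
    \<open>j\<close>-th function of several members, even if these functions differ.\<close>
  have "\<forall>k\<in>{..<K}. \<exists>d. bij_betw d {..<s'} (as k)"
    using asg ex_bij_betw_nat_finite finite_subset
    by (metis atLeast0LessThan finite_lessThan lessThan_iff)
  then obtain d where d: "\<And>k. k < K \<Longrightarrow> bij_betw (d k) {..<s'} (as k)"
    by (metis lessThan_iff)
  \<comment> \<open>\<open>pos b k (p, l)\<close> will be the position, in a value wanted by
    \<open>k\<close>, of the \<open>l\<close>-th bit entrusted to member \<open>p\<close>.\<close>
  have "\<exists>p. bij_betw p ((G b - {k}) \<times> {..<L}) {..<r' * L}" if "b \<in> B" "k \<in> G b" for b k
    using that G fin_G by (intro finite_same_card_bij) auto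
  then obtain pos where
    pos: "\<And>b k. b \<in> B \<Longrightarrow> k \<in> G b \<Longrightarrow> bij_betw (pos b k) ((G b - {k}) \<times> {..<L}) {..<r' * L}"
    by metis
  have "\<exists>xs. set xs = {..<s'} \<times> {b \<in> B. k \<in> G b} \<times> {..<L} \<and> distinct xs" for k
    using B by (intro finite_distinct_list) auto
  then obtain xs where xs: "\<And>k. set (xs k) = {..<s'} \<times> {b \<in> B. k \<in> G b} \<times> {..<L}"
    and distinct_xs: "\<And>k. distinct (xs k)"
    by metis
  define bit where "bit v k = (\<lambda>(j, b, l).
    odd (card {p \<in> G b - {k}. v (d p j) (f b p) ! pos b p (k, l)}))"
    for v :: "nat \<Rightarrow> nat \<Rightarrow> bits" and k
  \<comment> \<open>The decoder is a placeholder, replaced at the end by the one from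
    \<open>cdc_scheme_of_determined\<close>.\<close>
  define S where "S = \<lparr>stored = st, assigned = as,
    msg_len = (\<lambda>k. s' * L * card {b \<in> B. k \<in> G b}),
    encode = (\<lambda>k iv. map (bit (\<lambda>q n. the (iv (q, n))) k) (xs k)),
    decode = undefined\<rparr>"
  have d_less: "d k j < Q" if "k < K" "j < s'" for k j
    using d[OF that(1)] asg[OF that(1)] that(2) by (auto dest: bij_betwE)
  \<comment> \<open>Node \<open>k\<close> stores the files wanted by the other members of its
    groups, so the encoder never applies \<open>the\<close> to \<open>None\<close>.\<close>
  have message: "message Q S v k = map (bit v k) (xs k)" if "k < K" for v k
  proof -
    have "bit (\<lambda>q n. the (known_ivas Q S v k (q, n))) k z = bit v k z" if mem: "z \<in> set (xs k)" for z
    proof -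
      obtain j b l where z: "z = (j, b, l)" "j < s'" "b \<in> B" "k \<in> G b"
        using mem unfolding xs by auto
      have "the (known_ivas Q S v k (d p j, f b p)) = v (d p j) (f b p)" if "p \<in> G b - {k}" for p
      proof -
        have "f b p \<in> st k"
          using that z known by blast
        moreover have "p < K"
          using that z G by blast
        ultimately show ?thesis
          using d_less z by (simp add: known_ivas_def S_def)
      qed
      then show ?thesis
        by (simp add: bit_def z(1) cong: conj_cong)
    qed
    then show ?thesis
      by (simp add: message_def S_def)
  qed
  have len_xs: "length (xs k) = s' * L * card {b \<in> B. k \<in> G b}" for k
    using distinct_card[OF distinct_xs, of k] by (simp add: xs card_cartesian_product mult.commute mult.left_commute)
  have determined: "v q n = v' q n"
    if v: "iva_family N Q (r' * L) v" and v': "iva_family N Q (r' * L) v'"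
      and ms: "messages K Q S v = messages K Q S v'"
      and iv: "known_ivas Q S v k = known_ivas Q S v' k"
      and k: "k < K" and q: "q \<in> assigned S k" and n: "n < N" for v v' k q n
  proof -
    have q_as: "q \<in> as k" and qQ: "q < Q"
      using q asg[OF k] by (auto simp: S_def)
    have local_eq: "v q' n' = v' q' n'" if "q' < Q" "n' \<in> st k" for q' n'
      using fun_cong[OF iv, of "(q', n')"] that by (simp add: known_ivas_def S_def)
    show ?thesis
    proof (cases "n \<in> st k")
      case True
      then show ?thesis
        using local_eq qQ by blast
    next
      case False
      obtain b where b: "b \<in> B" "k \<in> G b" "f b k = n"
        using cover[OF k n False] by blast
      have "q \<in> d k ` {..<s'}"
        using bij_betw_imp_surj_on[OF d[OF k]] q_as by simp
      then obtain j where j: "j < s'" "d k j = q"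
        by blast
      show ?thesis
      proof (rule nth_equalityI)
        show "length (v q n) = length (v' q n)"
          using v v' qQ n by (simp add: iva_family_def)
      next
        fix i
        assume "i < length (v q n)"
        then have "i \<in> {..<r' * L}"
          using v qQ n by (simp add: iva_family_def)
        then have "i \<in> pos b k ` ((G b - {k}) \<times> {..<L})"
          using pos[OF b(1,2)] by (simp add: bij_betw_def)
        \<comment> \<open>Bit \<open>i\<close> of the wanted value was entrusted to member
          \<open>p\<close>; it is recovered from the bit of \<open>p\<close> indexed by
          \<open>(j, b, l)\<close>.\<close>
        then obtain p l where pl: "p \<in> G b - {k}" "l < L" "pos b k (p, l) = i"
          by blast
        have pK: "p < K"
          using pl(1) G[OF b(1)] by auto
        have "message Q S v p = message Q S v' p"
          using ms pK by (simp add: messages_def)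
        then have "map (bit v p) (xs p) = map (bit v' p) (xs p)"
          using message pK by simp
        moreover have "(j, b, l) \<in> set (xs p)"
          using j(1) b(1) pl by (simp add: xs)
        ultimately have "bit v p (j, b, l) = bit v' p (j, b, l)"
          by (simp only: map_eq_conv)
        then have parity: "odd (card {p' \<in> G b - {p}. v (d p' j) (f b p') ! pos b p' (p, l)}) =
            odd (card {p' \<in> G b - {p}. v' (d p' j) (f b p') ! pos b p' (p, l)})"
          by (simp add: bit_def)
        \<comment> \<open>All other summands of that bit belong to files stored at \<open>k\<close>,
          hence agree for \<open>v\<close> and \<open>v'\<close>.\<close>
        have "v (d k j) (f b k) ! pos b k (p, l) \<longleftrightarrow> v' (d k j) (f b k) ! pos b k (p, l)"
        proof (rule odd_card_eq_imp[OF _ _ _ parity])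
          show "finite (G b - {p})" "k \<in> G b - {p}"
            using fin_G b pl(1) by auto
        next
          fix p'
          assume "p' \<in> G b - {p} - {k}"
          then have "p' < K" "f b p' \<in> st k"
            using G[OF b(1)] known[OF b(1) _ b(2)] by blast+
          then show "v (d p' j) (f b p') ! pos b p' (p, l) \<longleftrightarrow>
              v' (d p' j) (f b p') ! pos b p' (p, l)"
            using local_eq d_less j(1) by simp
        qed
        then show "v q n ! i = v' q n ! i"
          using j b pl by simp
      qed
    qed
  qed
  have rng: "stored S k \<subseteq> {..<N} \<and> assigned S k \<subseteq> {..<Q}" if "k < K" for k
    using st[OF that] asg[OF that] by (simp add: S_def)
  have len: "length (message Q S v k) = msg_len S k" if "k < K" for v k
    using message[OF that] len_xs by (simp add: S_def)
  show thesis
  proof (rule cdc_scheme_of_determined[of K S N Q "r' * L"])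
    fix D
    assume "cdc_scheme K N Q (r' * L) (S\<lparr>decode := D\<rparr>)"
    then show thesis
      by (rule that) (simp_all add: S_def)
  qed (fact rng len determined)+
qed

section \<open>Counting residues and pairs of quotient and remainder\<close>

lemma bij_betw_add_mod:
  fixes Q a :: nat
  shows "bij_betw (\<lambda>x. (x + a) mod Q) {..<Q} {..<Q}"
proof -
  have "inj_on (\<lambda>x. (x + a) mod Q) {..<Q}"
  proof (rule inj_onI)
    fix x y
    assume "x \<in> {..<Q}" "y \<in> {..<Q}" "(x + a) mod Q = (y + a) mod Q"
    then show "x = y"
      using cong_add_rcancel_nat[of x a y Q] by (simp add: cong_def)
  qed
  moreover have "(\<lambda>x. (x + a) mod Q) ` {..<Q} \<subseteq> {..<Q}"
    by auto
  ultimately show ?thesis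
    by (simp add: bij_betw_def endo_inj_surj)
qed

text \<open>A shift permutes the residues. By the symmetry of \<open>q + k\<close>, this counts both
  the functions of a node and the nodes of a function within a block of \<open>Q\<close> consecutive
  nodes.\<close>

lemma card_add_mod_less:
  fixes Q a s' :: nat
  assumes "s' \<le> Q"
  shows "card {x. x < Q \<and> (x + a) mod Q < s'} = s'"
proof -
  define h where "h = (\<lambda>x. (x + a) mod Q)"
  have h: "inj_on h {..<Q}" "h ` {..<Q} = {..<Q}"
    using bij_betw_add_mod[of a Q] by (simp_all add: bij_betw_def h_def)
  have "card {x \<in> {..<Q}. h x < s'} = card (h ` {x \<in> {..<Q}. h x < s'})"
    using h(1) by (intro card_image[symmetric]) (auto intro: inj_on_subset)
  also have "h ` {x \<in> {..<Q}. h x < s'} = h ` {..<Q} \<inter> {..<s'}"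
    by blast
  also have "\<dots> = {..<s'}"
    using assms by (auto simp: h(2))
  finally show ?thesis
    by (simp add: h_def)
qed

text \<open>Division with remainder turns an interval into a grid. It is applied to nodes as pairs
  (coordinate, value) and to nodes cut into blocks of length \<open>Q\<close>.\<close>

lemma card_div_mod:
  fixes g Q :: nat
  shows "card {k. k < g * Q \<and> P (k div Q) (k mod Q)} = card (SIGMA i:{..<g}. {x. x < Q \<and> P i x})"
proof (cases "Q = 0")
  case False
  have "bij_betw (\<lambda>k. (k div Q, k mod Q)) {k. k < g * Q \<and> P (k div Q) (k mod Q)}
      (SIGMA i:{..<g}. {x. x < Q \<and> P i x})"
  proof (rule bij_betw_byWitness[where f' = "\<lambda>(i, x). i * Q + x"])
    have "i * Q + x < g * Q" if "i < g" "x < Q" for i x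
    proof -
      have "i * Q + x < Suc i * Q"
        using that by simp
      also have "\<dots> \<le> g * Q"
        using that by (intro mult_right_mono) auto
      finally show ?thesis .
    qed
    then show "(\<lambda>(i, x). i * Q + x) ` (SIGMA i:{..<g}. {x. x < Q \<and> P i x})
        \<subseteq> {k. k < g * Q \<and> P (k div Q) (k mod Q)}"
      by auto
  qed (use False in \<open>auto simp: less_mult_imp_div_less\<close>)
  then show ?thesis
    by (rule bij_betw_same_card)
qed simp

section \<open>Vectors with coordinate sum zero or nonzero modulo \<open>m\<close>\<close>

text \<open>The sum becomes \<open>x + a\<close>, where \<open>a\<close> collects the other
  coordinates, and adding \<open>a\<close> permutes the residues modulo \<open>m\<close>.\<close>

lemma coordinate_sum_zero:
  fixes m :: nat
  assumes "m > 0" "finite I" "i \<in> I"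
  shows "\<exists>!x. x < m \<and> m dvd (\<Sum>j\<in>I. (c(i := x)) j)"
proof -
  define a where "a = (\<Sum>j\<in>I - {i}. c j)"
  have "(\<Sum>j\<in>I. (c(i := x)) j) = x + a" for x
    using assms by (simp add: sum.remove[of I i] a_def)
  moreover have "\<exists>!x. x \<in> {..<m} \<and> (x + a) mod m = 0"
    using bij_betw_add_mod[of a m] assms(1) unfolding bij_betw_iff_bijections
    by (metis lessThan_iff)
  ultimately show ?thesis
    by (simp add: dvd_eq_mod_eq_0)
qed

text \<open>The last coordinate is determined by the others, so dropping it is a bijection onto all
  vectors of length \<open>t - 1\<close>.\<close>

lemma card_sum_zero_vectors:
  fixes m t :: nat
  assumes "m > 0" "t > 0"
  shows "card {c \<in> {..<t} \<rightarrow>\<^sub>E {..<m}. m dvd sum c {..<t}} = m ^ (t - 1)"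
proof -
  obtain u where t: "t = Suc u"
    using assms(2) gr0_implies_Suc by blast
  let ?B = "{c \<in> {..<t} \<rightarrow>\<^sub>E {..<m}. m dvd sum c {..<t}}"
  have unique: "\<exists>!x. x < m \<and> m dvd (\<Sum>j<t. (c(u := x)) j)" for c
    using coordinate_sum_zero[of m "{..<t}" u c] assms t by simp
  have "bij_betw (\<lambda>c. restrict c {..<u}) ?B ({..<u} \<rightarrow>\<^sub>E {..<m})"
  proof (rule bij_betw_imageI)
    show "inj_on (\<lambda>c. restrict c {..<u}) ?B"
    proof (rule inj_onI)
      fix c c'
      assume c: "c \<in> ?B" and c': "c' \<in> ?B" and eq: "restrict c {..<u} = restrict c' {..<u}"
      have "c' = c(u := c' u)"
      proof
        fix j
        consider "j < u" | "j = u" | "j > u"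
          by linarith
        then show "c' j = (c(u := c' u)) j"
        proof cases
          case 1
          then show ?thesis
            using fun_cong[OF eq, of j] by simp
        next
          \<comment> \<open>Outside the index range both vectors take the default value of
            extensional functions.\<close>
          case 3
          then show ?thesis
            using c c' t by (auto simp: PiE_def extensional_def)
        qed simp
      qed
      moreover have "m dvd (\<Sum>j<t. (c(u := c u)) j)" "c u < m" "c' u < m"
        using c c' t by auto
      moreover have "m dvd sum c' {..<t}"
        using c' by simp
      ultimately show "c = c'"
        using unique[of c] by (metis fun_upd_triv)
    qed
    show "(\<lambda>c. restrict c {..<u}) ` ?B = {..<u} \<rightarrow>\<^sub>E {..<m}"
    proof (intro equalityI image_subsetI subsetI)
      fix c
      assume "c \<in> ?B"
      then have "c j \<in> {..<m}" if "j < u" for j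
        using that t by (intro PiE_mem[of c "{..<t}"]) simp_all
      then show "restrict c {..<u} \<in> {..<u} \<rightarrow>\<^sub>E {..<m}"
        by (simp add: restrict_PiE_iff)
    next
      fix e
      assume e: "e \<in> {..<u} \<rightarrow>\<^sub>E {..<m}"
      obtain x where x: "x < m" "m dvd (\<Sum>j<t. (e(u := x)) j)"
        using unique by blast
      have "e(u := x) \<in> ?B"
        using e x t by (auto simp: PiE_def extensional_def Pi_def less_Suc_eq)
      moreover have "restrict (e(u := x)) {..<u} = e"
        using e by (auto simp: fun_eq_iff PiE_def extensional_def)
      ultimately show "e \<in> (\<lambda>c. restrict c {..<u}) ` ?B"
        by (intro image_eqI[of _ _ "e(u := x)"]) simp_all
    qed
  qed
  then have "card ?B = card ({..<u} \<rightarrow>\<^sub>E {..<m})"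
    by (rule bij_betw_same_card)
  then show ?thesis
    by (simp add: card_PiE t)
qed

lemma card_sum_nonzero_vectors:
  fixes m t :: nat
  assumes "m > 0" "t > 0"
  shows "card {c \<in> {..<t} \<rightarrow>\<^sub>E {..<m}. \<not> m dvd sum c {..<t}} = (m - 1) * m ^ (t - 1)"
proof -
  let ?V = "{..<t} \<rightarrow>\<^sub>E {..<m}"
  have "finite ?V"
    by (simp add: finite_PiE)
  moreover have "{c \<in> ?V. \<not> m dvd sum c {..<t}} = ?V - {c \<in> ?V. m dvd sum c {..<t}}"
    by auto
  ultimately have "card {c \<in> ?V. \<not> m dvd sum c {..<t}} =
      card ?V - card {c \<in> ?V. m dvd sum c {..<t}}"
    by (simp add: card_Diff_subset)
  also have "\<dots> = m ^ t - m ^ (t - 1)"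
    using assms by (simp add: card_PiE card_sum_zero_vectors)
  also have "\<dots> = (m - 1) * m ^ (t - 1)"
    using assms(2) by (cases t) (simp_all add: diff_mult_distrib)
  finally show ?thesis .
qed

text \<open>Each coordinate excludes exactly one of its \<open>m\<close> nodes. This gives both the
  size of a group and the number of nodes storing a file.\<close>

lemma card_avoiding_nodes:
  fixes m t :: nat
  assumes "c \<in> {..<t} \<rightarrow>\<^sub>E {..<m}"
  shows "card {k. k < t * m \<and> c (k div m) \<noteq> k mod m} = t * (m - 1)"
proof -
  have "card {x. x < m \<and> c i \<noteq> x} = m - 1" if "i < t" for i
  proof -
    have "{x. x < m \<and> c i \<noteq> x} = {..<m} - {c i}"
      by auto
    moreover have "c i \<in> {..<m}"
      using assms that by auto
    ultimately show ?thesis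
      by simp
  qed
  then show ?thesis
    using card_div_mod[of t m "\<lambda>i x. c i \<noteq> x"] by simp
qed

section \<open>The scheme built from these vectors, and its loads\<close>

theorem mainTheorem4:
  fixes K t s r T N Q :: nat
  assumes "K > 0" and "s > 0" and "t \<ge> 2" and "t dvd K" and "t < K" and "s \<le> K"
    and "r = K - t"
    and "T > 0" and "(r - 1) dvd T"
    and "N = (K div t - 1) * (K div t) ^ (t - 1)"
    and "Q = K div gcd K s"
  shows "\<exists>S. cdc_scheme K N Q T S
    \<and> (\<forall>q<Q. computed_by_exactly K s S q)
    \<and> computation_load K N S = real r
    \<and> communication_load K N Q T S = real s / (real r - 1) * (1 - real r / real K)"
proof -
  define m where "m = K div t"
  have K: "K = t * m"
    using assms(4) by (simp add: m_def)
  have m: "m \<ge> 2"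
  proof -
    have "t * 1 < t * m"
      using assms(5) K by simp
    then show ?thesis
      by simp
  qed
  have r: "r = t * (m - 1)"
    using assms(7) K by (simp add: diff_mult_distrib2)
  have r2: "r \<ge> 2"
    using mult_le_mono[of 2 t 1 "m - 1"] assms(3) m r by simp
  define r' where "r' = r - 1"
  have r': "r = Suc r'" "r' > 0"
    using r2 by (auto simp: r'_def)
  obtain L where T: "T = r' * L"
    using assms(9) by (auto simp: r'_def)
  have L: "L > 0"
    using T assms(8) by simp
  define g where "g = gcd K s"
  have g: "g > 0"
    using assms(1) by (simp add: g_def)
  have KQ: "K = g * Q"
    using assms(11) by (simp add: g_def)
  \<comment> \<open>\<open>s'\<close> is the number of functions per node: counting pairs (node,
    function) gives \<open>K * s' = Q * s\<close>.\<close>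
  define s' where "s' = s div g"
  have s: "s = g * s'"
    by (simp add: s'_def g_def)
  have s'Q: "s' \<le> Q"
    using assms(6) g unfolding KQ s by simp
  have Q: "Q > 0"
    using assms(1) KQ by (metis gr0I mult_0_right)

  define F where "F = {c \<in> {..<t} \<rightarrow>\<^sub>E {..<m}. \<not> m dvd sum c {..<t}}"
  define B where "B = {c \<in> {..<t} \<rightarrow>\<^sub>E {..<m}. m dvd sum c {..<t}}"
  have fin: "finite F" "finite B"
    by (simp_all add: F_def B_def finite_PiE)
  have cardF: "card F = N"
    using card_sum_nonzero_vectors[of m t] m assms(3,10) by (simp add: F_def m_def)
  have cardB: "card B = m ^ (t - 1)"
    using card_sum_zero_vectors[of m t] m assms(3) by (simp add: B_def)
  \<comment> \<open>Files have to be numbers below \<open>N\<close>; \<open>vec\<close> and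
    \<open>idx\<close> translate between them and the vectors in \<open>F\<close>.\<close>
  obtain vec where vec: "bij_betw vec {..<N} F"
    using ex_bij_betw_nat_finite[OF fin(1)] cardF by (auto simp: atLeast0LessThan)
  define idx where "idx = the_inv_into {..<N} vec"
  have idx: "idx c < N" "vec (idx c) = c" if "c \<in> F" for c
    using that vec bij_betw_the_inv_into[OF vec] f_the_inv_into_f_bij_betw[OF vec]
    by (auto simp: idx_def dest: bij_betwE)
  have idx_vec: "idx (vec n) = n" if "n < N" for n
    using that vec by (simp add: idx_def bij_betw_def the_inv_into_f_f)
  have vecF: "vec n \<in> F" if "n < N" for n
    using that vec by (auto dest: bij_betwE)

  define G where "G b = {k. k < K \<and> b (k div m) \<noteq> k mod m}" for b :: "nat \<Rightarrow> nat"
  define st where "st k = {n \<in> {..<N}. vec n (k div m) \<noteq> k mod m}" for k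
  \<comment> \<open>Node \<open>k\<close> gets a cyclic window of \<open>s'\<close> consecutive
    functions that moves back by one from each node to the next.\<close>
  define as where "as k = {q. q < Q \<and> (q + k) mod Q < s'}" for k
  define f where "f b k = idx (b(k div m := k mod m))" for b k
  have node: "k div m < t" "k mod m < m" if "k < K" for k
    using that K m by (auto simp: less_mult_imp_div_less)
  have unique: "\<exists>!x. x < m \<and> m dvd (\<Sum>j<t. (c(i := x)) j)" if "i < t" for c i
    using coordinate_sum_zero[of m "{..<t}" i c] m that by simp
  have cardG: "card (G c) = r" if "c \<in> {..<t} \<rightarrow>\<^sub>E {..<m}" for c
    using card_avoiding_nodes[OF that] by (simp add: G_def K r)
  have upd: "c(k div m := x) \<in> {..<t} \<rightarrow>\<^sub>E {..<m}"
    if "c \<in> {..<t} \<rightarrow>\<^sub>E {..<m}" "k < K" "x < m" for c k x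
    using that node by (auto simp: PiE_def extensional_def Pi_def)
  have wanted: "b(k div m := k mod m) \<in> F" if "b \<in> B" "k \<in> G b" for b k
  proof -
    have k: "k < K" "b (k div m) \<noteq> k mod m"
      using that(2) by (auto simp: G_def)
    have "m dvd (\<Sum>j<t. (b(k div m := b (k div m))) j)" "b (k div m) < m"
      using that(1) node[OF k(1)] by (auto simp: B_def)
    \<comment> \<open>The coordinate of \<open>b\<close> itself is the only value giving sum zero,
      and \<open>k mod m\<close> differs from it.\<close>
    then have "\<not> m dvd (\<Sum>j<t. (b(k div m := k mod m)) j)"
      using unique[OF node(1)[OF k(1)], of b] k node by blast
    then show ?thesis
      using that(1) upd k node by (simp add: F_def B_def)
  qed
  obtain S where S: "cdc_scheme K N Q (r' * L) S" "stored S = st" "assigned S = as"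
    "\<And>k. msg_len S k = s' * L * card {b \<in> B. k \<in> G b}"
  proof (rule coded_multicast_scheme[of B G K r' st N as Q s' f L])
    show "G b \<subseteq> {..<K} \<and> card (G b) = Suc r'" if "b \<in> B" for b
      using that cardG r' by (auto simp: B_def G_def)
    show "as k \<subseteq> {..<Q} \<and> card (as k) = s'" for k
      using card_add_mod_less[OF s'Q] by (auto simp: as_def)
    show "f b k < N" if "b \<in> B" "k \<in> G b" for b k
      using wanted[OF that] idx by (simp add: f_def)
    show "f b k \<in> st k'" if "b \<in> B" "k \<in> G b" "k' \<in> G b" "k' \<noteq> k" for b k k'
    proof -
      \<comment> \<open>If \<open>k'\<close> shares the changed coordinate with \<open>k\<close>,
        its value differs from the new entry; otherwise the entry it checks is that of
        \<open>b\<close>, and \<open>k' \<in> G b\<close> applies.\<close>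
      have "k' mod m \<noteq> k mod m" if "k' div m = k div m"
        using \<open>k' \<noteq> k\<close> that by (metis div_mult_mod_eq)
      then show ?thesis
        using that wanted[OF that(1,2)] idx by (auto simp: f_def st_def G_def)
    qed
    show "\<exists>b\<in>B. k \<in> G b \<and> f b k = n" if k: "k < K" and n: "n < N" "n \<notin> st k" for k n
    proof -
      define c where "c = vec n"
      have c: "c \<in> {..<t} \<rightarrow>\<^sub>E {..<m}" "\<not> m dvd sum c {..<t}"
        using vecF[OF n(1)] by (auto simp: F_def c_def)
      have ck: "c (k div m) = k mod m"
        using k n by (simp add: st_def c_def)
      \<comment> \<open>The group serving \<open>k\<close> with file \<open>c\<close> is found by
        correcting coordinate \<open>k div m\<close> to make the sum zero. This changes
        \<open>c\<close>, whose sum is nonzero, so \<open>k\<close> lies in the group.\<close>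
      obtain x where x: "x < m" "m dvd (\<Sum>j<t. (c(k div m := x)) j)"
        using unique[OF node(1)[OF k], of c] by blast
      have "x \<noteq> k mod m"
        using x(2) c(2) ck by (metis fun_upd_triv)
      then have "c(k div m := x) \<in> B" "k \<in> G (c(k div m := x))"
        using x c upd k by (auto simp: B_def G_def)
      moreover have "f (c(k div m := x)) k = n"
        using ck idx_vec[OF n(1)] by (simp add: f_def c_def flip: ck)
      ultimately show ?thesis
        by blast
    qed
  qed (use fin in \<open>auto simp: st_def\<close>)

  have "computed_by_exactly K s S q" if "q < Q" for q
  proof -
    \<comment> \<open>Membership depends only on \<open>k mod Q\<close>, so each of the
      \<open>g\<close> blocks of \<open>Q\<close> nodes contributes \<open>s'\<close>.\<close>
    have "card {k. k < K \<and> q \<in> as k} = card {k. k < g * Q \<and> (k mod Q + q) mod Q < s'}"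
      using that KQ by (simp add: as_def mod_simps add.commute)
    also have "\<dots> = s"
      using card_div_mod[of g Q "\<lambda>_ x. (x + q) mod Q < s'"] card_add_mod_less[OF s'Q] s by simp
    finally show ?thesis
      by (simp add: computed_by_exactly_def S)
  qed
  moreover have "computation_load K N S = real r"
  proof -
    \<comment> \<open>Double counting: every file is stored at exactly \<open>r\<close>
      nodes.\<close>
    have "(\<Sum>k<K. card (st k)) = r * card {..<N}"
      unfolding st_def
    proof (rule sum_multicount)
      show "\<forall>n\<in>{..<N}. card {k \<in> {..<K}. vec n (k div m) \<noteq> k mod m} = r"
        using cardG vecF by (simp add: F_def G_def)
    qed simp_all
    then have "(\<Sum>k<K. real (card (st k))) = real r * real N"
      by (metis card_lessThan of_nat_mult of_nat_sum)
    moreover have "N > 0"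
      using assms(10) m by (simp flip: m_def)
    ultimately show ?thesis
      by (simp add: computation_load_def S)
  qed
  moreover have "communication_load K N Q T S = real s / (real r - 1) * (1 - real r / real K)"
  proof -
    have "(\<Sum>k<K. card {b \<in> B. k \<in> G b}) = r * card B"
    proof (rule sum_multicount)
      have "{k \<in> {..<K}. k \<in> G b} = G b" for b
        by (auto simp: G_def)
      then show "\<forall>b\<in>B. card {k \<in> {..<K}. k \<in> G b} = r"
        using cardG by (simp add: B_def)
    qed (use fin in simp_all)
    then have "(\<Sum>k<K. msg_len S k) = s' * L * (r * m ^ (t - 1))"
      by (simp add: S cardB flip: sum_distrib_left)
    \<comment> \<open>Here
      \<open>r * m ^ (t - 1) = t * (m - 1) * m ^ (t - 1) = t * N\<close>.\<close>
    then have "(\<Sum>k<K. real (msg_len S k)) =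
        real s' * real L * (real t * real N)"
      using assms(10) by (simp add: r flip: m_def of_nat_sum)
    moreover have "real T = (real r - 1) * real L"
      by (simp add: T r')
    moreover have "real N > 0" "real r - 1 > 0"
      using assms(10) m r2 by (simp_all flip: m_def)
    ultimately have "communication_load K N Q T S =
        real s' * real t / (real Q * (real r - 1))"
      using L Q by (simp add: communication_load_def divide_simps)
    \<comment> \<open>Multiplying numerator and denominator by \<open>g\<close> turns
      \<open>s' / Q\<close> into \<open>s / K\<close>.\<close>
    also have "\<dots> = real s / (real r - 1) * (real t / real K)"
      using g by (simp add: s KQ field_simps)
    also have "real t / real K = 1 - real r / real K"
      using assms(1,5,7) by (simp add: of_nat_diff diff_divide_distrib)
    finally show ?thesis .
  qed
  ultimately show ?thesis
    using S(1) T by blast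
qed

end
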